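(* No family of crosses with four positive arms tiles a half-plane, even if the crosses have different arm lengths. That is, there is no collection of subsets of $\mathbb{Z}^2$, each of which is an integer translate of some $P(a,b,c,d)$ with integers $a,b,c,d\ge 1$ (where $a,b,c,d$ may vary from one member of the collection to another), such that each member is contained in the half-plane $\{(x,y)\in\mathbb{Z}^2:y\ge 0\}$, the members are pairwise disjoint, and their union is $\{(x,y)\in\mathbb{Z}^2:y\ge 0\}$.
   Context: Cells of the square grid are identified with points of $\mathbb{Z}^2$. For natural numbers $a,b,c,d\ge 0$, $$P(a,b,c,d)=\{(x,0):-c\le x\le a\}\cup\{(0,y):-d\le y\le b\}\subset\mathbb{Z}^2 .$$ (Rotations and reflections of such crosses are again translates of crosses of this form with permuted arm lengths.) *)

theory Defs
  imports Main "HOL-Library.Disjoint_Sets" "HOL-Library.Product_Plus"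
begin

definition cross :: "nat \<Rightarrow> nat \<Rightarrow> nat \<Rightarrow> nat \<Rightarrow> (int \<times> int) set" where
  "cross a b c d =
     {(x, 0) | x. - int c \<le> x \<and> x \<le> int a} \<union> {(0, y) | y. - int d \<le> y \<and> y \<le> int b}"

definition translate :: "int \<times> int \<Rightarrow> (int \<times> int) set \<Rightarrow> (int \<times> int) set" where
  "translate v S = (\<lambda>p. v + p) ` S"

definition half_plane :: "(int \<times> int) set" where
  "half_plane = {(x, y). y \<ge> 0}"

definition tiles :: "(int \<times> int) set set \<Rightarrow> (int \<times> int) set \<Rightarrow> bool" where
  "tiles T R \<longleftrightarrow> (\<forall>C\<in>T. C \<subseteq> R) \<and> disjoint T \<and> \<Union>T = R"

end

theory Submission
  imports Defs
begin

text \<open>A cross inside the half-plane has its centre strictly above the boundary, so it meets the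
  boundary only with the tip of its lower arm. Hence two adjacent boundary cells belong to different
  crosses with centres in adjacent columns, and a horizontal arm of the cross whose centre is
  not higher runs into the vertical bar of the other.\<close>

lemma mem_translate_cross:
  "(x, y) \<in> translate (p, q) (cross a b c d) \<longleftrightarrow>
     (y = q \<and> p - int c \<le> x \<and> x \<le> p + int a) \<or> (x = p \<and> q - int d \<le> y \<and> y \<le> q + int b)"
proof -
  have "(x, y) = (p, q) + z \<longleftrightarrow> z = (x - p, y - q)" for z
    by (cases z) auto
  then have "(x, y) \<in> translate (p, q) (cross a b c d) \<longleftrightarrow> (x - p, y - q) \<in> cross a b c d"
    by (simp add: translate_def image_iff)
  then show ?thesis
    by (auto simp: cross_def)
qed

text \<open>\<open>h\<close> will be the height of the centre, which sits in column
  \<open>x\<close>: the cells at \<open>x - 1\<close> and \<open>x + 1\<close> begin the two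
  horizontal arms. The last conclusion later tells apart the crosses over two adjacent boundary
  cells.\<close>

lemma boundary_cross_shape:
  assumes "a \<ge> 1" "c \<ge> 1" "d \<ge> 1" and C: "C = translate v (cross a b c d)"
    and "C \<subseteq> half_plane" and "(x, 0) \<in> C"
  obtains h where "h \<ge> 0" "(x - 1, h) \<in> C" "(x + 1, h) \<in> C"
    "\<And>y. 0 \<le> y \<Longrightarrow> y \<le> h \<Longrightarrow> (x, y) \<in> C" "(x + 1, 0) \<notin> C"
proof -
  obtain p q where v: "v = (p, q)"
    by (cases v)
  have mem: "(s, t) \<in> C \<longleftrightarrow>
      (t = q \<and> p - int c \<le> s \<and> s \<le> p + int a) \<or> (s = p \<and> q - int d \<le> t \<and> t \<le> q + int b)"
    for s t
    unfolding C v by (rule mem_translate_cross)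
  \<comment> \<open>The tip of the lower arm has nonnegative height, which lifts the centre off row
    0.\<close>
  have "(p, q - int d) \<in> C"
    by (simp add: mem)
  then have "q \<ge> int d"
    using \<open>C \<subseteq> half_plane\<close> by (auto simp: half_plane_def)
  with \<open>d \<ge> 1\<close> have "q \<ge> 1"
    by linarith
  \<comment> \<open>Row 0 is not the row of the centre, so \<open>(x, 0)\<close> lies on the
    vertical bar; \<open>q \<le> int d\<close> says that this bar reaches down to row 0.\<close>
  with \<open>(x, 0) \<in> C\<close> have "x = p" "q \<le> int d"
    by (auto simp: mem)
  with \<open>q \<ge> 1\<close> \<open>a \<ge> 1\<close> \<open>c \<ge> 1\<close> show thesis
    by (intro that[of q]) (auto simp: mem)
qed

theorem lemma8p1:
  shows "\<not> (\<exists>T :: (int \<times> int) set set.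
           (\<forall>C\<in>T. \<exists>a b c d v. a \<ge> 1 \<and> b \<ge> 1 \<and> c \<ge> 1 \<and> d \<ge> 1 \<and> C = translate v (cross a b c d)) \<and>
           tiles T half_plane)"
proof (rule notI, elim exE conjE)
  fix T :: "(int \<times> int) set set"
  assume crosses: "\<forall>C\<in>T. \<exists>a b c d v. a \<ge> 1 \<and> b \<ge> 1 \<and> c \<ge> 1 \<and> d \<ge> 1 \<and>
      C = translate v (cross a b c d)"
    and tiles: "tiles T half_plane"
  have sub: "C \<subseteq> half_plane" if "C \<in> T" for C
    using tiles that by (auto simp: tiles_def)
  have "(0, 0) \<in> \<Union>T" "(1, 0) \<in> \<Union>T"
    using tiles by (auto simp: tiles_def half_plane_def)
  then obtain C D where C: "C \<in> T" "(0, 0) \<in> C" and D: "D \<in> T" "(1, 0) \<in> D"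
    by blast
  \<comment> \<open>Of the horizontal arms only the one facing the other cross is kept: the right
    one of \<open>C\<close>, and below the left one of \<open>D\<close>.\<close>
  obtain h where h: "h \<ge> 0" "(1, h) \<in> C" "\<And>y. 0 \<le> y \<Longrightarrow> y \<le> h \<Longrightarrow> (0, y) \<in> C" "(1, 0) \<notin> C"
  proof -
    obtain a b c d v where "a \<ge> 1" "c \<ge> 1" "d \<ge> 1" "C = translate v (cross a b c d)"
      using bspec[OF crosses C(1)] by blast
    then show thesis
      by (rule boundary_cross_shape[OF _ _ _ _ sub[OF C(1)] C(2)]) (auto intro: that)
  qed
  obtain k where k: "k \<ge> 0" "(0, k) \<in> D" "\<And>y. 0 \<le> y \<Longrightarrow> y \<le> k \<Longrightarrow> (1, y) \<in> D"
  proof -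
    obtain a b c d v where "a \<ge> 1" "c \<ge> 1" "d \<ge> 1" "D = translate v (cross a b c d)"
      using bspec[OF crosses D(1)] by blast
    then show thesis
      by (rule boundary_cross_shape[OF _ _ _ _ sub[OF D(1)] D(2)]) (auto intro: that)
  qed
  have "disjoint T" "C \<noteq> D"
    using tiles D(2) h(4) by (auto simp: tiles_def)
  then have disj: "C \<inter> D = {}"
    using C(1) D(1) by (simp add: disjointD)
  show False
  \<comment> \<open>The lower centre decides which cell is shared: \<open>(1, h)\<close> if
    \<open>h \<le> k\<close>, and \<open>(0, k)\<close> otherwise.\<close>
  proof (cases "h \<le> k")
    case True
    with disj h(1,2) k(3)[of h] show False
      by blast
  next
    case False
    with disj k(1,2) h(3)[of k] show False
      by (simp add: disjoint_iff)
  qed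
qed

end
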